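(* Let $n\geq 1$ be an integer. If $n$ is odd, then for every $\lambda_1\in[0,\tfrac12]$, $$n!\sum_{i=0}^{n}\frac{(-1)^i}{i!}=\left\lfloor \frac{n!}{e}+\lambda_1\right\rfloor .$$ If $n$ is even, then for every $\lambda_2\in[\tfrac13,1]$, $$n!\sum_{i=0}^{n}\frac{(-1)^i}{i!}=\left\lfloor \frac{n!}{e}+\lambda_2\right\rfloor .$$
   Context: $\lfloor x\rfloor$ denotes the floor of the real number $x$. *)

theory Defs
  imports Complex_Main
begin

end

theory Submission
  imports Defs
begin

text \<open>The partial sums of the alternating series for \<open>1/e\<close> lie alternately below and above the
  limit, so \<open>n!/e\<close> differs from the integer \<open>n! \<Sum>\<^sub>i (-1)\<^sup>i/i!\<close> by less than \<open>1/(n+1)\<close>,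
  upwards for odd \<open>n\<close> and downwards for even \<open>n\<close>.\<close>

definition exp_neg_partial_sum :: "nat \<Rightarrow> real" where
  "exp_neg_partial_sum n = (\<Sum>i=0..n. (-1) ^ i / fact i)"

lemma exp_neg_partial_sum_Suc:
  "exp_neg_partial_sum (Suc n) = exp_neg_partial_sum n + (-1) ^ Suc n / fact (Suc n)"
  by (simp add: exp_neg_partial_sum_def)

text \<open>Multiplying by \<open>fact n\<close> gives the derangement numbers, which satisfy the
  integer recurrence D(n+1) = (n+1) D(n) + (-1)^(n+1).\<close>

lemma fact_mult_exp_neg_partial_sum_in_Ints: "fact n * exp_neg_partial_sum n \<in> \<int>"
proof (induction n)
  case 0
  show ?case by (simp add: exp_neg_partial_sum_def)
next
  case (Suc n)
  have "fact (Suc n) * exp_neg_partial_sum (Suc n)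
      = of_nat (Suc n) * (fact n * exp_neg_partial_sum n) + (-1) ^ Suc n"
    by (simp add: exp_neg_partial_sum_Suc distrib_left del: of_nat_Suc power_Suc)
  also have "\<dots> \<in> \<int>"
    by (intro Ints_add Ints_mult Suc.IH Ints_power Ints_of_nat) auto
  finally show ?case .
qed

text \<open>Leibniz criterion for the series of 1/e. The even case is strict because the upper
  bounds under the floor must stay strict at the endpoints 1/2 and 1 of the ranges of
  \<lambda>.\<close>

lemma exp_neg_partial_sum_bounds:
  shows exp_neg_partial_sum_odd_le: "odd n \<Longrightarrow> exp_neg_partial_sum n \<le> exp (-1)"
    and exp_neg_partial_sum_even_gt: "even n \<Longrightarrow> exp (-1) < exp_neg_partial_sum n"
proof -
  define a :: "nat \<Rightarrow> real" where "a k = 1 / fact k" for k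
  \<comment> \<open>The Leibniz bounds count terms, and the sum up to \<open>k\<close> has
    \<open>Suc k\<close> of them, so odd indices match even numbers of terms and vice versa.\<close>
  have eq: "(\<Sum>i<Suc k. (-1) ^ i * a i) = exp_neg_partial_sum k" for k
    by (simp add: a_def exp_neg_partial_sum_def lessThan_Suc_atMost atMost_atLeast0)
  have sums: "(\<lambda>i. (-1) ^ i * a i) sums exp (-1)"
    using exp_converges[of "-1 :: real"] by (simp add: a_def divide_inverse mult.commute)
  have lim: "a \<longlonglongrightarrow> 0"
    unfolding a_def using summable_LIMSEQ_zero[OF summable_exp[of "1 :: real"]]
    by (simp add: divide_inverse)
  have nonneg: "0 \<le> a k" and decr: "a (Suc k) \<le> a k" for k
    unfolding a_def by (auto simp del: fact_Suc intro!: divide_left_mono fact_mono)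
  note leibniz = summable_Leibniz'[of a, OF lim nonneg decr, folded sums_unique[OF sums]]
  show "exp_neg_partial_sum n \<le> exp (-1)" if "odd n"
  proof -
    from that obtain m where "Suc n = 2 * Suc m" by (auto elim!: oddE)
    then show ?thesis using leibniz(2)[of "Suc m"] eq[of n] by simp
  qed
  show "exp (-1) < exp_neg_partial_sum n" if "even n"
  proof -
    from that obtain m where m: "n = 2 * m" by (auto elim!: evenE)
    \<comment> \<open>Leibniz yields only a weak inequality; strictness comes from applying it two
      terms later, since those two terms lower the sum by a positive amount.\<close>
    have "exp (-1) \<le> exp_neg_partial_sum (Suc (Suc n))"
      using leibniz(4)[of "Suc m"] eq[of "Suc (Suc n)"] m by simp
    also have "\<dots> = exp_neg_partial_sum n - (1 / fact (Suc n) - 1 / fact (Suc (Suc n)))"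
      using that by (simp add: exp_neg_partial_sum_Suc del: fact_Suc)
    also have "\<dots> < exp_neg_partial_sum n"
    proof -
      \<comment> \<open>Factorials increase strictly only from 1 on; both arguments here are
        positive, so the tie 0! = 1! does not arise.\<close>
      have "(fact (Suc n) :: real) < fact (Suc (Suc n))" by (rule fact_less_mono) auto
      then have "1 / fact (Suc (Suc n)) < (1 / fact (Suc n) :: real)"
        by (intro divide_strict_left_mono) (auto simp del: fact_Suc)
      then show ?thesis by linarith
    qed
    finally show ?thesis .
  qed
qed

text \<open>Scaled by \<open>fact n\<close>, the next term is only 1/(n+1) in size; the bound at the
  opposite parity \<open>Suc n\<close> thus controls how far n!/e lies from the integer.\<close>

lemma fact_mult_exp_neg_partial_sum_Suc:
  "fact n * exp_neg_partial_sum (Suc n)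
    = fact n * exp_neg_partial_sum n + (-1) ^ Suc n / real (Suc n)"
  by (simp add: exp_neg_partial_sum_Suc distrib_left del: of_nat_Suc power_Suc)

theorem theorem2:
  fixes n :: nat
  assumes "n \<ge> 1"
  shows "(odd n \<longrightarrow> (\<forall>l1 \<in> {0..1/2 :: real}.
             fact n * (\<Sum>i=0..n. (-1) ^ i / fact i :: real)
               = real_of_int \<lfloor>fact n / exp (1 :: real) + l1\<rfloor>)) \<and>
         (even n \<longrightarrow> (\<forall>l2 \<in> {1/3..1 :: real}.
             fact n * (\<Sum>i=0..n. (-1) ^ i / fact i :: real)
               = real_of_int \<lfloor>fact n / exp (1 :: real) + l2\<rfloor>))"
proof -
  define D where "D = fact n * exp_neg_partial_sum n"
  define x :: real where "x = fact n * exp (-1)"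
  have x: "fact n / exp (1 :: real) = x"
    by (simp add: x_def exp_minus divide_inverse)
  obtain z where z: "D = of_int z"
    using fact_mult_exp_neg_partial_sum_in_Ints[of n] unfolding D_def by (elim Ints_cases)
  have floor: "D = real_of_int \<lfloor>x + l\<rfloor>" if "D \<le> x + l" "x + l < D + 1" for l
    using that z by (simp add: floor_unique)
  have "D = real_of_int \<lfloor>x + l\<rfloor>" if "odd n" "l \<in> {0..1/2}" for l
  proof (rule floor)
    have "D \<le> x"
      using exp_neg_partial_sum_odd_le[OF \<open>odd n\<close>] by (simp add: D_def x_def)
    then show "D \<le> x + l" using that by simp
    have "x < fact n * exp_neg_partial_sum (Suc n)"
      using exp_neg_partial_sum_even_gt[of "Suc n"] \<open>odd n\<close> by (simp add: x_def)
    also have "\<dots> = D + 1 / real (Suc n)"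
      using \<open>odd n\<close> by (simp add: fact_mult_exp_neg_partial_sum_Suc D_def)
    \<comment> \<open>The constant 1/2 is 1/(n+1) at the smallest odd n, namely 1.\<close>
    also have "1 / real (Suc n) \<le> 1 / 2"
      using assms by (intro divide_left_mono) auto
    finally show "x + l < D + 1" using that by simp
  qed
  moreover have "D = real_of_int \<lfloor>x + l\<rfloor>" if "even n" "l \<in> {1/3..1}" for l
  proof (rule floor)
    have "x < D"
      using exp_neg_partial_sum_even_gt[OF \<open>even n\<close>] by (simp add: D_def x_def)
    then show "x + l < D + 1" using that by simp
    \<comment> \<open>The smallest positive even n is 2, whence the constant 1/3 as the largest
      possible 1/(n+1).\<close>
    have "n \<ge> 2" using assms \<open>even n\<close> by (cases "n = 1") auto
    then have "1 / real (Suc n) \<le> 1 / 3"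
      by (intro divide_left_mono) auto
    moreover have "D - 1 / real (Suc n) = fact n * exp_neg_partial_sum (Suc n)"
      using \<open>even n\<close> by (simp add: fact_mult_exp_neg_partial_sum_Suc D_def)
    moreover have "\<dots> \<le> x"
      using exp_neg_partial_sum_odd_le[of "Suc n"] \<open>even n\<close> by (simp add: x_def)
    moreover have "1 / 3 \<le> l" using that by simp
    ultimately show "D \<le> x + l" by linarith
  qed
  ultimately show ?thesis
    unfolding x D_def exp_neg_partial_sum_def by blast
qed

end
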